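(* Let $S_1\ge \|f'\|_{C[-1,1]}=2$. Let $\{\phi^n\}_{n=0}^N\subset\mathbb V_h$ be a solution of the DsBE scheme, i.e. $\phi^0=\phi_{\mathrm{init}}$ on $\Omega_h$ and, for $0\le n\le N-1$, $$\frac{\phi^{n+1}-\phi^n}{\tau_{n+1}}=-\mathcal M(\phi^n)\,\mu^{n+1},\qquad \mu^{n+1}=-\varepsilon^2\Delta_h\phi^{n+1}-f(\phi^n)+S_1(\phi^{n+1}-\phi^n),$$ with products and compositions taken pointwise on the grid. Then the scheme unconditionally preserves the discrete maximum bound principle: with no restriction on the sizes of $\tau_1,\dots,\tau_N>0$ and $h>0$, if $\|\phi_{\mathrm{init}}\|_\infty\le 1$ then $\|\phi^{n+1}\|_\infty\le 1$ for all $0\le n\le N-1$.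
   Context: The scheme discretizes the Allen--Cahn equation $\phi_t=-\mathcal M(\phi)\mu$, $\mu=-\varepsilon^2\Delta\phi-f(\phi)$ on $\Omega=[0,L]^d$, $d\in\{1,2,3\}$, with periodic boundary conditions and initial datum $\phi_{\mathrm{init}}$. Here $\varepsilon>0$, $F(s)=\frac14(1-s^2)^2$, $f(s)=-F'(s)=s-s^3$. The mobility $\mathcal M$ is a nonnegative, possibly degenerate (it may vanish) real function; only its values on $[-1,1]$ matter (e.g. $\mathcal M(s)=(1-s^2)^m$, $m>0$). Spatial grid: $M$ is a positive integer, $h=L/M$, $\Omega_h=\{\mathbf x_{\mathbf i}=h\mathbf i:\mathbf i\in\{1,\dots,M\}^d\}$. $\mathbb V_h$ is the set of real-valued grid functions $v=\{v_{\mathbf i}\}$ that are $M$-periodic in each index. $\|v\|_\infty=\max_{\mathbf x_{\mathbf i}\in\Omega_h}|v_{\mathbf i}|$. $\Delta_h$ is the standard second-order central difference Laplacian with periodic indices: $(\Delta_h v)_{\mathbf i}=h^{-2}\sum_{k=1}^d (v_{\mathbf i+\mathbf e_k}-2v_{\mathbf i}+v_{\mathbf i-\mathbf e_k})$, $\mathbf e_k$ being the $k$-th coordinate vector. Time grid: $0=t_0<t_1<\dots<t_N=T$, $\tau_k=t_k-t_{k-1}$ (variable step sizes). *)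

theory Defs
  imports "HOL-Analysis.Analysis"
begin

definition double_well :: "real \<Rightarrow> real" where
  "double_well s = (1 / 4) * (1 - s\<^sup>2)\<^sup>2"

definition reaction :: "real \<Rightarrow> real" where
  "reaction s = s - s ^ 3"

lemma reaction_eq_neg_deriv: "reaction s = - deriv double_well s"
proof -
  have "(double_well has_real_derivative - reaction s) (at s)"
    unfolding double_well_def[abs_def] reaction_def
    by (auto intro!: derivative_eq_intros simp: algebra_simps power2_eq_square power3_eq_cube)
  then show ?thesis by (simp add: DERIV_imp_deriv)
qed

lemma deriv_reaction: "deriv reaction s = 1 - 3 * s\<^sup>2"
  unfolding reaction_def[abs_def]
  by (intro DERIV_imp_deriv) (auto intro!: derivative_eq_intros)

definition C_norm :: "real \<Rightarrow> real \<Rightarrow> (real \<Rightarrow> real) \<Rightarrow> real" where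
  "C_norm a b g = (SUP s\<in>{a..b}. \<bar>g s\<bar>)"

lemma C_norm_deriv_reaction: "C_norm (-1) 1 (deriv reaction) = 2"
  unfolding C_norm_def deriv_reaction
proof (rule cSup_eq_maximum)
  show "2 \<in> (\<lambda>s::real. \<bar>1 - 3 * s\<^sup>2\<bar>) ` {-1..1}"
    by (intro image_eqI[where x = 1]) auto
next
  fix y assume "y \<in> (\<lambda>s::real. \<bar>1 - 3 * s\<^sup>2\<bar>) ` {-1..1}"
  then obtain s :: real where s: "\<bar>s\<bar> \<le> 1" "y = \<bar>1 - 3 * s\<^sup>2\<bar>" by (auto simp: abs_le_iff)
  have "s\<^sup>2 \<le> 1" using s(1) by (simp add: abs_square_le_1)
  moreover have "0 \<le> s\<^sup>2" by simp
  ultimately show "y \<le> 2" unfolding s(2) by linarith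
qed

text \<open>
  Grid functions are indexed by all of \<open>\<int>^d\<close>, with \<open>d = CARD('d)\<close>; periodicity
  identifies them with functions on the \<open>M^d\<close> grid points \<open>h i\<close>, \<open>i \<in> grid_index M\<close>.
\<close>

definition grid_index :: "nat \<Rightarrow> (int ^ 'd) set" where
  "grid_index M = {i. \<forall>k. i $ k \<in> {1..int M}}"

definition grid_point :: "real \<Rightarrow> int ^ 'd \<Rightarrow> real ^ 'd" where
  "grid_point h i = (\<chi> k. h * real_of_int (i $ k))"

definition grid_functions :: "nat \<Rightarrow> (int ^ 'd \<Rightarrow> real) set" where
  "grid_functions M = {v. \<forall>i k. v (i + axis k (int M)) = v i}"

definition grid_norm :: "nat \<Rightarrow> (int ^ 'd \<Rightarrow> real) \<Rightarrow> real" where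
  "grid_norm M v = Max ((\<lambda>i. \<bar>v i\<bar>) ` grid_index M)"

lemma finite_grid_index: "finite (grid_index M :: (int ^ 'd) set)"
proof (rule finite_subset)
  show "(grid_index M :: (int ^ 'd) set) \<subseteq> (\<lambda>f. \<chi> k. f k) ` (UNIV \<rightarrow>\<^sub>E {1..int M})"
  proof
    fix i :: "int ^ 'd" assume "i \<in> grid_index M"
    then show "i \<in> (\<lambda>f. \<chi> k. f k) ` (UNIV \<rightarrow>\<^sub>E {1..int M})"
      by (intro image_eqI[where x = "\<lambda>k. i $ k"]) (auto simp: grid_index_def)
  qed
qed (auto intro!: finite_imageI finite_PiE)

lemma grid_index_nonempty: "0 < M \<Longrightarrow> (grid_index M :: (int ^ 'd) set) \<noteq> {}"
  unfolding grid_index_def by (auto intro!: exI[where x = "\<chi> k. 1"])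

definition discrete_laplacian :: "real \<Rightarrow> (int ^ 'd \<Rightarrow> real) \<Rightarrow> int ^ 'd \<Rightarrow> real" where
  "discrete_laplacian h v i =
     (\<Sum>k\<in>UNIV. v (i + axis k 1) - 2 * v i + v (i - axis k 1)) / h\<^sup>2"

definition time_grid :: "nat \<Rightarrow> real \<Rightarrow> (nat \<Rightarrow> real) \<Rightarrow> bool" where
  "time_grid N T t \<longleftrightarrow> t 0 = 0 \<and> (\<forall>n<N. t n < t (Suc n)) \<and> t N = T"

definition time_step :: "(nat \<Rightarrow> real) \<Rightarrow> nat \<Rightarrow> real" where
  "time_step t k = t k - t (k - 1)"

text \<open>The chemical potential \<open>\<mu>^{n+1}\<close>, for \<open>u = \<phi>^n\<close> and \<open>v = \<phi>^{n+1}\<close>.\<close>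

definition DsBE_potential ::
    "real \<Rightarrow> real \<Rightarrow> real \<Rightarrow> (int ^ 'd \<Rightarrow> real) \<Rightarrow> (int ^ 'd \<Rightarrow> real) \<Rightarrow> int ^ 'd \<Rightarrow> real" where
  "DsBE_potential \<epsilon> h S\<^sub>1 u v i =
     - \<epsilon>\<^sup>2 * discrete_laplacian h v i - reaction (u i) + S\<^sub>1 * (v i - u i)"

definition DsBE_solution ::
    "real \<Rightarrow> real \<Rightarrow> nat \<Rightarrow> (real \<Rightarrow> real) \<Rightarrow> real \<Rightarrow> nat \<Rightarrow> (nat \<Rightarrow> real)
      \<Rightarrow> (real ^ 'd \<Rightarrow> real) \<Rightarrow> (nat \<Rightarrow> int ^ 'd \<Rightarrow> real) \<Rightarrow> bool" where
  "DsBE_solution \<epsilon> L M mob S\<^sub>1 N t \<phi>\<^sub>i\<^sub>n\<^sub>i\<^sub>t \<phi> \<longleftrightarrow>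
     (let h = L / real M in
       (\<forall>n\<le>N. \<phi> n \<in> grid_functions M) \<and>
       (\<forall>i\<in>grid_index M. \<phi> 0 i = \<phi>\<^sub>i\<^sub>n\<^sub>i\<^sub>t (grid_point h i)) \<and>
       (\<forall>n<N. \<forall>i\<in>grid_index M.
          (\<phi> (Suc n) i - \<phi> n i) / time_step t (Suc n) =
            - mob (\<phi> n i) * DsBE_potential \<epsilon> h S\<^sub>1 (\<phi> n) (\<phi> (Suc n)) i))"

end

theory Submission
  imports Defs
begin

text \<open>
  At a grid point where \<open>v = \<phi>^{n+1}\<close> is maximal the discrete Laplacian is nonpositive, so with
  \<open>u = \<phi>^n\<close> and \<open>m = \<tau> M(u) \<ge> 0\<close> the scheme gives \<open>(1 + m S\<^sub>1) v \<le> u + m (f(u) + S\<^sub>1 u)\<close> there.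
  For \<open>\<bar>u\<bar> \<le> 1\<close> and \<open>S\<^sub>1 \<ge> 2\<close> the right-hand side is at most \<open>1 + m S\<^sub>1\<close>, since
  \<open>S\<^sub>1 - f(u) - S\<^sub>1 u = (1 - u) (S\<^sub>1 - u (1 + u))\<close>. The lower bound follows
  because the scheme is invariant under \<open>(u, v) \<mapsto> (-u, -v)\<close>.
\<close>

lemma grid_norm_le_iff:
  fixes v :: "int ^ 'd \<Rightarrow> real"
  assumes "M > 0"
  shows "grid_norm M v \<le> c \<longleftrightarrow> (\<forall>i\<in>grid_index M. \<bar>v i\<bar> \<le> c)"
  unfolding grid_norm_def
  by (subst Max_le_iff) (auto simp: finite_grid_index grid_index_nonempty[OF assms])

text \<open>A unit shift leaves the index box only through a face in direction \<open>k\<close>, and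
  one period brings it back in at the opposite face. Hence a bound on the box also controls the
  stencil values outside it.\<close>

lemma grid_functions_neighbour:
  fixes v :: "int ^ 'd \<Rightarrow> real"
  assumes v: "v \<in> grid_functions M" and i: "i \<in> grid_index M"
  shows "v (i + axis k 1) \<in> v ` grid_index M" and "v (i - axis k 1) \<in> v ` grid_index M"
proof -
  have per: "v (j + axis k (int M)) = v j" for j
    using v by (simp add: grid_functions_def)
  show "v (i + axis k 1) \<in> v ` grid_index M"
  proof (cases "i $ k = int M")
    case True
    \<comment> \<open>The right neighbour moved back by one period; its \<open>k\<close>-th
      coordinate is 1.\<close>
    let ?j = "i + axis k (1 - int M)"
    have "?j + axis k (int M) = i + axis k 1"
      by (simp add: vec_eq_iff axis_def)
    moreover have "?j \<in> grid_index M"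
      using i True by (force simp: grid_index_def axis_def)
    ultimately show ?thesis
      using per[of ?j] by (metis image_eqI)
  next
    case False
    have "i + axis k 1 \<in> grid_index M"
      unfolding grid_index_def
    proof (clarify)
      fix l
      show "(i + axis k 1) $ l \<in> {1..int M}"
        using i False by (cases "l = k") (auto simp: grid_index_def axis_def order_less_le dest: spec[of _ l])
    qed
    then show ?thesis by blast
  qed
  show "v (i - axis k 1) \<in> v ` grid_index M"
  proof (cases "i $ k = 1")
    case True
    \<comment> \<open>The left neighbour moved forward by one period; its \<open>k\<close>-th
      coordinate is \<open>M\<close>.\<close>
    let ?j = "i - axis k 1 + axis k (int M)"
    have "?j \<in> grid_index M"
      using i True by (force simp: grid_index_def axis_def)
    then show ?thesis
      using per[of "i - axis k 1"] by (intro image_eqI[where x = ?j]) auto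
  next
    case False
    have "i - axis k 1 \<in> grid_index M"
      unfolding grid_index_def
    proof (clarify)
      fix l
      show "(i - axis k 1) $ l \<in> {1..int M}"
        using i False by (cases "l = k") (auto simp: grid_index_def axis_def order_less_le dest: spec[of _ l])
    qed
    then show ?thesis by blast
  qed
qed

text \<open>By periodicity the neighbours of \<open>i\<close> also carry values attained on the box,
  so neither exceeds \<open>v i\<close> and each second difference is nonpositive.\<close>

lemma discrete_laplacian_le_0_at_max:
  fixes v :: "int ^ 'd \<Rightarrow> real"
  assumes "v \<in> grid_functions M" and "i \<in> grid_index M"
    and max: "\<And>j. j \<in> grid_index M \<Longrightarrow> v j \<le> v i"
  shows "discrete_laplacian h v i \<le> 0"
proof -
  have "v (i + axis k 1) \<le> v i" "v (i - axis k 1) \<le> v i" for k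
    using grid_functions_neighbour[OF assms(1,2), of k] max by auto
  then have "(\<Sum>k\<in>UNIV. v (i + axis k 1) - 2 * v i + v (i - axis k 1)) \<le> 0"
    by (intro sum_nonpos) (smt (verit))
  then show ?thesis
    unfolding discrete_laplacian_def by (simp add: divide_nonpos_nonneg)
qed

lemma stabilized_reaction_le:
  assumes "\<bar>u\<bar> \<le> 1" and "S \<ge> 2"
  shows "reaction u + S * u \<le> S"
proof -
  \<comment> \<open>As \<open>1 + u\<close> is at most 2, hence at most \<open>S\<close>, this makes
    the second factor of the product below nonnegative.\<close>
  have "u * (1 + u) \<le> 1 * (1 + u)"
    using assms(1) by (intro mult_right_mono) auto
  then have "0 \<le> (1 - u) * (S - u * (1 + u))"
    using assms by (intro mult_nonneg_nonneg) auto
  also have "\<dots> = S - (reaction u + S * u)"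
    by (simp add: reaction_def algebra_simps power3_eq_cube)
  finally show ?thesis by simp
qed

text \<open>The Laplacian is linear and \<open>reaction\<close> is odd. This symmetry turns the
  upper bound into the lower one.\<close>

lemma DsBE_potential_minus:
  "DsBE_potential \<epsilon> h S (\<lambda>j. - u j) (\<lambda>j. - v j) i = - DsBE_potential \<epsilon> h S u v i"
proof -
  have "discrete_laplacian h (\<lambda>j. - v j) i =
      (\<Sum>k\<in>UNIV. - (v (i + axis k 1) - 2 * v i + v (i - axis k 1))) / h\<^sup>2"
    unfolding discrete_laplacian_def by (simp add: algebra_simps)
  also have "\<dots> = - discrete_laplacian h v i"
    unfolding discrete_laplacian_def sum_negf by simp
  finally have "discrete_laplacian h (\<lambda>j. - v j) i = - discrete_laplacian h v i" .
  then show ?thesis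
    by (simp add: DsBE_potential_def reaction_def algebra_simps)
qed

text \<open>The weight \<open>m\<close> stands for the time step times the mobility at the old
  values. With the division by the time step cleared, only its sign matters, and points of zero
  mobility are covered.\<close>

lemma DsBE_step_upper_bound:
  fixes u v m :: "int ^ 'd \<Rightarrow> real"
  assumes "M > 0" and "S \<ge> 2" and v: "v \<in> grid_functions M"
    and u: "\<And>i. i \<in> grid_index M \<Longrightarrow> \<bar>u i\<bar> \<le> 1"
    and m: "\<And>i. i \<in> grid_index M \<Longrightarrow> 0 \<le> m i"
    and step: "\<And>i. i \<in> grid_index M \<Longrightarrow> v i - u i = - m i * DsBE_potential \<epsilon> h S u v i"
    and "j \<in> grid_index M"
  shows "v j \<le> 1"
proof -
  have "Max (v ` grid_index M) \<in> v ` grid_index M"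
    using \<open>M > 0\<close> by (intro Max_in) (auto simp: finite_grid_index grid_index_nonempty)
  then obtain i where i: "i \<in> grid_index M" and "v i = Max (v ` grid_index M)"
    by force
  then have max: "v k \<le> v i" if "k \<in> grid_index M" for k
    using that by (simp add: finite_grid_index)
  have "\<epsilon>\<^sup>2 * discrete_laplacian h v i \<le> 0"
    using discrete_laplacian_le_0_at_max[OF v i max] by (simp add: mult_nonneg_nonpos)
  moreover have "reaction (u i) + S * u i \<le> S"
    using u[OF i] \<open>S \<ge> 2\<close> by (rule stabilized_reaction_le)
  \<comment> \<open>The stabilized reaction bound eliminates \<open>u i\<close>, leaving a
    right-hand side whose sign is that of \<open>1 - v i\<close>.\<close>
  ultimately have "- DsBE_potential \<epsilon> h S u v i \<le> S * (1 - v i)"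
    unfolding DsBE_potential_def by (simp add: algebra_simps)
  from mult_left_mono[OF this m[OF i]]
  have le: "v i - u i \<le> m i * (S * (1 - v i))"
    using step[OF i] by simp
  have "v i \<le> 1"
  proof (rule ccontr)
    \<comment> \<open>A maximum above 1 would make the right-hand side of \<open>le\<close>
      nonpositive, forcing \<open>v i\<close> below \<open>u i\<close>, which is at most 1.\<close>
    assume "\<not> v i \<le> 1"
    then have "m i * (S * (1 - v i)) \<le> 0"
      using m[OF i] \<open>S \<ge> 2\<close> by (intro mult_nonneg_nonpos) auto
    with le u[OF i] \<open>\<not> v i \<le> 1\<close> show False by linarith
  qed
  with max[OF \<open>j \<in> grid_index M\<close>] show ?thesis by linarith
qed

lemma DsBE_step_bound:
  fixes u v m :: "int ^ 'd \<Rightarrow> real"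
  assumes "M > 0" and "S \<ge> 2" and v: "v \<in> grid_functions M"
    and u: "\<And>i. i \<in> grid_index M \<Longrightarrow> \<bar>u i\<bar> \<le> 1"
    and m: "\<And>i. i \<in> grid_index M \<Longrightarrow> 0 \<le> m i"
    and step: "\<And>i. i \<in> grid_index M \<Longrightarrow> v i - u i = - m i * DsBE_potential \<epsilon> h S u v i"
    and j: "j \<in> grid_index M"
  shows "\<bar>v j\<bar> \<le> 1"
proof -
  have "v j \<le> 1"
    using assms by (rule DsBE_step_upper_bound)
  moreover have "- v j \<le> 1"
  \<comment> \<open>The weights \<open>m\<close> stay unchanged under the reflection: they are fixed
    numbers here, so no evenness of the mobility enters.\<close>
  proof (rule DsBE_step_upper_bound[OF \<open>M > 0\<close> \<open>S \<ge> 2\<close>, where u = "\<lambda>i. - u i" and m = m])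
    show "(\<lambda>i. - v i) \<in> grid_functions M"
      using v by (simp add: grid_functions_def)
    show "- v i - - u i = - m i * DsBE_potential \<epsilon> h S (\<lambda>i. - u i) (\<lambda>i. - v i) i"
      if "i \<in> grid_index M" for i
      using step[OF that] by (simp add: DsBE_potential_minus)
  qed (use u m j in auto)
  ultimately show ?thesis by linarith
qed

theorem theorem2p4:
  fixes \<epsilon> L S\<^sub>1 T :: real
    and M N :: nat
    and mob :: "real \<Rightarrow> real"
    and t :: "nat \<Rightarrow> real"
    and \<phi>\<^sub>i\<^sub>n\<^sub>i\<^sub>t :: "real ^ 'd \<Rightarrow> real"
    and \<phi> :: "nat \<Rightarrow> int ^ 'd \<Rightarrow> real"
  assumes "CARD('d) \<in> {1, 2, 3}"
    and "\<epsilon> > 0" and "L > 0" and "M > 0"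
    and "\<And>s. s \<in> {-1..1} \<Longrightarrow> mob s \<ge> 0"
    and "time_grid N T t"
    and "S\<^sub>1 \<ge> C_norm (-1) 1 (deriv reaction)"
    and "DsBE_solution \<epsilon> L M mob S\<^sub>1 N t \<phi>\<^sub>i\<^sub>n\<^sub>i\<^sub>t \<phi>"
    and "grid_norm M (\<lambda>i. \<phi>\<^sub>i\<^sub>n\<^sub>i\<^sub>t (grid_point (L / real M) i)) \<le> 1"
  shows "\<forall>n<N. grid_norm M (\<phi> (Suc n)) \<le> 1"
proof -
  let ?h = "L / real M"
  have S: "S\<^sub>1 \<ge> 2"
    using assms(7) by (simp add: C_norm_deriv_reaction)
  have per: "\<phi> n \<in> grid_functions M" if "n \<le> N" for n
    using assms(8) that by (simp add: DsBE_solution_def Let_def)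
  have bound: "\<forall>i\<in>grid_index M. \<bar>\<phi> n i\<bar> \<le> 1" if "n \<le> N" for n
    using that
  proof (induction n)
    case 0
    then show ?case
      using assms(8,9) by (simp add: DsBE_solution_def Let_def grid_norm_le_iff[OF \<open>M > 0\<close>])
  next
    case (Suc n)
    have tau: "0 < time_step t (Suc n)"
      using assms(6) Suc.prems by (simp add: time_grid_def time_step_def)
    \<comment> \<open>The sign of \<open>mob\<close> is known only on [-1,1]; the induction
      hypothesis places the old values there.\<close>
    have mob: "0 \<le> mob (\<phi> n i)" if "i \<in> grid_index M" for i
      using Suc that by (intro assms(5)) (auto simp: abs_le_iff dest!: bspec)
    show ?case
    proof
      fix j :: "int ^ 'd" assume j: "j \<in> grid_index M"
      show "\<bar>\<phi> (Suc n) j\<bar> \<le> 1"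
      proof (rule DsBE_step_bound[OF \<open>M > 0\<close> S per[OF Suc.prems] _ _ _ j])
        fix i :: "int ^ 'd" assume i: "i \<in> grid_index M"
        show "\<bar>\<phi> n i\<bar> \<le> 1"
          using Suc i by simp
        show "0 \<le> time_step t (Suc n) * mob (\<phi> n i)"
          using tau mob[OF i] by simp
        have "(\<phi> (Suc n) i - \<phi> n i) / time_step t (Suc n) =
            - mob (\<phi> n i) * DsBE_potential \<epsilon> ?h S\<^sub>1 (\<phi> n) (\<phi> (Suc n)) i"
          using assms(8) Suc.prems i by (simp add: DsBE_solution_def Let_def)
        then show "\<phi> (Suc n) i - \<phi> n i = - (time_step t (Suc n) * mob (\<phi> n i)) *
            DsBE_potential \<epsilon> ?h S\<^sub>1 (\<phi> n) (\<phi> (Suc n)) i"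
          using tau by (simp add: field_simps)
      qed
    qed
  qed
  then show ?thesis
    by (simp add: grid_norm_le_iff[OF \<open>M > 0\<close>])
qed

end
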